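(* Let $\mathbf X=\{(X_{n,1},\dots,X_{n,d})\}_{n\ge1}$ be a $d$-dimensional stationary sequence having multivariate upcrossings index $\eta^{\mathbf X}(\boldsymbol\nu)>0$, $\boldsymbol\nu\in(0,\infty)^d$. Then for any nonempty $J=\{i_1,\dots,i_s\}\subset\{1,\dots,d\}$, the $s$-dimensional sequence $\mathbf X_{i_1,\dots,i_s}=\{(X_{n,i_1},\dots,X_{n,i_s})\}_{n\ge1}$ has upcrossings index $$\eta^{\mathbf X_{i_1,\dots,i_s}}(\boldsymbol\nu')=\lim_{\substack{\nu_j\to0^+,\ j\in\bar J\\ \boldsymbol\nu\in\overline T(\boldsymbol\nu')}}\eta^{\mathbf X}(\boldsymbol\nu),\qquad \boldsymbol\nu'\in(0,\infty)^s,$$ where the coordinates of $\boldsymbol\nu'=(\nu'_{i_1},\dots,\nu'_{i_s})$ are indexed by $J$, $\overline T(\boldsymbol\nu')=\{\boldsymbol\nu\in(0,\infty)^d:\ \nu_j=\nu'_j,\ j\in J\}$ and $\bar J=\{1,\dots,d\}\setminus J$.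
   Context: For an $m$-dimensional stationary sequence $\mathbf X=\{(X_{n,1},\dots,X_{n,m})\}_{n\ge1}$ and $\boldsymbol\nu\in(0,\infty)^m$, "levels $\tilde{\mathbf u}^{(\boldsymbol\nu)}$" means a sequence $\mathbf u=\{(u_{n,1}^{(\nu_1)},\dots,u_{n,m}^{(\nu_m)})\}_{n\ge1}$ in $\mathbb R^m$ such that $nP(X_{1,j}\le u_{n,j}^{(\nu_j)}<X_{2,j})\to\nu_j$ as $n\to\infty$ for each $j$. Given such levels, $\mathbf S_n^{(\boldsymbol\nu)}=(S_{n,1},\dots,S_{n,m})$ with $S_{n,j}(B)=\sum_{i=1}^n\mathbf 1_{\{X_{i,j}\le u_{n,j}^{(\nu_j)}<X_{i+1,j}\}}\delta_{i/n}(B)$, $B\subset[0,1]$, $\delta_a$ the unit mass at $a$. So $\{\mathbf S_n^{(\boldsymbol\nu)}([0,1])=\mathbf 0\}$ is the event that no component has an upcrossing of its level at times $1,\dots,n$. Definition (upcrossings index). $\mathbf X$ has (multivariate) upcrossings index $\eta(\boldsymbol\nu)$, $\boldsymbol\nu\in(0,\infty)^m$, if for each $\boldsymbol\nu\in(0,\infty)^m$ there exist levels $\tilde{\mathbf u}^{(\boldsymbol\nu)}$ and, for all levels $\tilde{\mathbf u}^{(\boldsymbol\nu)}$, $$\lim_{n\to\infty}\exp\Big(-nP\Big(\bigcup_{j=1}^m\{X_{1,j}\le u_{n,j}^{(\nu_j)}<X_{2,j}\}\Big)\Big)=\varphi(\boldsymbol\nu)$$ and $$\lim_{n\to\infty}P(\mathbf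 S_n^{(\boldsymbol\nu)}([0,1])=\mathbf 0)=(\varphi(\boldsymbol\nu))^{\eta(\boldsymbol\nu)},\qquad 0\le\eta(\boldsymbol\nu)\le1,$$ where $\varphi(\boldsymbol\nu)$ and $\eta(\boldsymbol\nu)$ depend only on $\boldsymbol\nu$. *)

theory Defs
  imports "HOL-Probability.Probability"
begin

text \<open>An $m$-dimensional sequence is a family \<open>X n j \<omega>\<close> with time \<open>n \<ge> 1\<close> (the value at \<open>n = 0\<close>
  is irrelevant) and component \<open>j\<close> in a finite index set \<open>I\<close> of size $m$. Passing to the
  subsequence of components in \<open>J \<subseteq> I\<close> amounts to keeping \<open>X\<close> and replacing \<open>I\<close> by \<open>J\<close>.
  Stationarity is strict: all finite-dimensional distributions are shift invariant.\<close>

locale stationary_sequence = prob_space M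
  for M :: "'a measure" +
  fixes I :: "'i set" and X :: "nat \<Rightarrow> 'i \<Rightarrow> 'a \<Rightarrow> real"
  assumes finite_index: "finite I" and index_nonempty: "I \<noteq> {}"
    and measurable_X: "\<And>n j. n \<ge> 1 \<Longrightarrow> j \<in> I \<Longrightarrow> X n j \<in> borel_measurable M"
    and stationary: "\<And>N h. finite N \<Longrightarrow> N \<subseteq> {1..} \<Longrightarrow>
      distr M (\<Pi>\<^sub>M n\<in>N. \<Pi>\<^sub>M j\<in>I. borel) (\<lambda>\<omega>. \<lambda>n\<in>N. \<lambda>j\<in>I. X (n + h) j \<omega>) =
      distr M (\<Pi>\<^sub>M n\<in>N. \<Pi>\<^sub>M j\<in>I. borel) (\<lambda>\<omega>. \<lambda>n\<in>N. \<lambda>j\<in>I. X n j \<omega>)"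

definition pos_orthant :: "'i set \<Rightarrow> ('i \<Rightarrow> real) set" where
  "pos_orthant I = (\<Pi>\<^sub>E j\<in>I. {0<..})"

definition levels ::
  "'a measure \<Rightarrow> 'i set \<Rightarrow> (nat \<Rightarrow> 'i \<Rightarrow> 'a \<Rightarrow> real) \<Rightarrow> ('i \<Rightarrow> real) \<Rightarrow> (nat \<Rightarrow> 'i \<Rightarrow> real) \<Rightarrow> bool"
  where
  "levels M I X \<nu> u \<longleftrightarrow>
     (\<forall>j\<in>I. (\<lambda>n. real n * measure M {\<omega> \<in> space M. X 1 j \<omega> \<le> u n j \<and> u n j < X 2 j \<omega>})
              \<longlonglongrightarrow> \<nu> j)"

text \<open>The point process $S_{n,j}$ of upcrossings, evaluated at the outcome \<open>\<omega>\<close> and the set \<open>B\<close>;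
  the unit mass at $i/n$ of \<open>B\<close> is \<open>indicator B (i / n)\<close>.\<close>

definition upcrossing_process ::
  "(nat \<Rightarrow> 'i \<Rightarrow> 'a \<Rightarrow> real) \<Rightarrow> (nat \<Rightarrow> 'i \<Rightarrow> real) \<Rightarrow> nat \<Rightarrow> 'i \<Rightarrow> 'a \<Rightarrow> real set \<Rightarrow> real" where
  "upcrossing_process X u n j \<omega> B =
     (\<Sum>i=1..n. of_bool (X i j \<omega> \<le> u n j \<and> u n j < X (i + 1) j \<omega>) * indicator B (real i / real n))"

text \<open>The index \<open>\<eta>\<close> and the function \<open>\<phi>\<close> only matter on \<open>pos_orthant I\<close>. There \<open>\<phi> \<nu>\<close> is
  positive, being at least \<open>exp (- (\<Sum>j\<in>I. \<nu> j))\<close>, so \<open>powr\<close> is the usual real power.\<close>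

definition has_upcrossings_index ::
  "'a measure \<Rightarrow> 'i set \<Rightarrow> (nat \<Rightarrow> 'i \<Rightarrow> 'a \<Rightarrow> real) \<Rightarrow> (('i \<Rightarrow> real) \<Rightarrow> real) \<Rightarrow> bool" where
  "has_upcrossings_index M I X \<eta> \<longleftrightarrow>
     (\<exists>\<phi> :: ('i \<Rightarrow> real) \<Rightarrow> real. \<forall>\<nu>\<in>pos_orthant I.
        (\<exists>u. levels M I X \<nu> u) \<and> 0 \<le> \<eta> \<nu> \<and> \<eta> \<nu> \<le> 1 \<and>
        (\<forall>u. levels M I X \<nu> u \<longrightarrow>
           (\<lambda>n. exp (- (real n *
              measure M (\<Union>j\<in>I. {\<omega> \<in> space M. X 1 j \<omega> \<le> u n j \<and> u n j < X 2 j \<omega>}))))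
             \<longlonglongrightarrow> \<phi> \<nu> \<and>
           (\<lambda>n. measure M {\<omega> \<in> space M. \<forall>j\<in>I. upcrossing_process X u n j \<omega> {0..1} = 0})
             \<longlonglongrightarrow> \<phi> \<nu> powr \<eta> \<nu>))"

definition T_bar :: "'i set \<Rightarrow> 'i set \<Rightarrow> ('i \<Rightarrow> real) \<Rightarrow> ('i \<Rightarrow> real) set" where
  "T_bar I J \<nu>' = {\<nu> \<in> pos_orthant I. \<forall>j\<in>J. \<nu> j = \<nu>' j}"

text \<open>The mode of convergence $\nu_j \to 0^+$ for $j \in I \setminus J$ (jointly), with $\nu$
  ranging over \<open>T_bar I J \<nu>'\<close>. For \<open>J = I\<close> and \<open>\<nu>' \<in> pos_orthant I\<close> this is the principal filter
  of \<open>{\<nu>'}\<close>, so that the limit is then the value at \<open>\<nu>'\<close>.\<close>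

definition vanishing_in_T_bar :: "'i set \<Rightarrow> 'i set \<Rightarrow> ('i \<Rightarrow> real) \<Rightarrow> ('i \<Rightarrow> real) filter" where
  "vanishing_in_T_bar I J \<nu>' =
     inf (principal (T_bar I J \<nu>')) (INF j\<in>I - J. filtercomap (\<lambda>\<nu>. \<nu> j) (at_right 0))"

lemma eventually_vanishing_in_T_bar:
  assumes "finite I"
  shows "eventually P (vanishing_in_T_bar I J \<nu>') \<longleftrightarrow>
    (\<exists>\<epsilon>>0. \<forall>\<nu>\<in>T_bar I J \<nu>'. (\<forall>j\<in>I - J. \<nu> j < \<epsilon>) \<longrightarrow> P \<nu>)"
proof
  assume "eventually P (vanishing_in_T_bar I J \<nu>')"
  then have "eventually (\<lambda>\<nu>. \<nu> \<in> T_bar I J \<nu>' \<longrightarrow> P \<nu>)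
      (INF j\<in>I - J. filtercomap (\<lambda>\<nu>. \<nu> j) (at_right (0::real)))"
    by (simp add: vanishing_in_T_bar_def inf_commute[of "principal _"] eventually_inf_principal)
  then obtain Q where Q: "\<And>j. j \<in> I - J \<Longrightarrow> eventually (Q j) (filtercomap (\<lambda>\<nu>. \<nu> j) (at_right (0::real)))"
    and QP: "\<And>\<nu>. (\<forall>j\<in>I - J. Q j \<nu>) \<Longrightarrow> \<nu> \<in> T_bar I J \<nu>' \<Longrightarrow> P \<nu>"
    using assms by (subst (asm) eventually_INF_finite) auto
  have "\<exists>e>0. \<forall>\<nu>. 0 < \<nu> j \<and> \<nu> j < e \<longrightarrow> Q j \<nu>" if j: "j \<in> I - J" for j
    using Q[OF j] unfolding eventually_filtercomap eventually_at_right_field by force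
  then obtain e where e: "\<And>j. j \<in> I - J \<Longrightarrow> e j > 0"
    "\<And>j \<nu>. j \<in> I - J \<Longrightarrow> 0 < \<nu> j \<Longrightarrow> \<nu> j < e j \<Longrightarrow> Q j \<nu>"
    by metis
  define \<epsilon> where "\<epsilon> = Min (insert 1 (e ` (I - J)))"
  have "\<epsilon> > 0" and le: "\<And>j. j \<in> I - J \<Longrightarrow> \<epsilon> \<le> e j"
    using assms e(1) by (auto simp: \<epsilon>_def)
  moreover have "P \<nu>" if "\<nu> \<in> T_bar I J \<nu>'" "\<forall>j\<in>I - J. \<nu> j < \<epsilon>" for \<nu>
  proof (rule QP)
    have "0 < \<nu> j" if "j \<in> I" for j
      using \<open>\<nu> \<in> T_bar I J \<nu>'\<close> that by (auto simp: T_bar_def pos_orthant_def PiE_def Pi_def)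
    then show "\<forall>j\<in>I - J. Q j \<nu>"
      using le that(2) by (meson DiffD1 e(2) less_le_trans)
  qed (use that in auto)
  ultimately show "\<exists>\<epsilon>>0. \<forall>\<nu>\<in>T_bar I J \<nu>'. (\<forall>j\<in>I - J. \<nu> j < \<epsilon>) \<longrightarrow> P \<nu>"
    by blast
next
  assume "\<exists>\<epsilon>>0. \<forall>\<nu>\<in>T_bar I J \<nu>'. (\<forall>j\<in>I - J. \<nu> j < \<epsilon>) \<longrightarrow> P \<nu>"
  then obtain \<epsilon> where \<epsilon>: "\<epsilon> > 0" "\<And>\<nu>. \<nu> \<in> T_bar I J \<nu>' \<Longrightarrow> (\<forall>j\<in>I - J. \<nu> j < \<epsilon>) \<Longrightarrow> P \<nu>"
    by blast
  have "eventually (\<lambda>\<nu>. \<nu> j < \<epsilon>) (filtercomap (\<lambda>\<nu>. \<nu> j) (at_right (0::real)))" for j :: 'a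
    using \<open>\<epsilon> > 0\<close> unfolding eventually_filtercomap eventually_at_right_field
    by (intro exI[of _ "\<lambda>x. x < \<epsilon>"]) auto
  then have "eventually (\<lambda>\<nu>. \<forall>j\<in>I - J. \<nu> j < \<epsilon>)
      (INF j\<in>I - J. filtercomap (\<lambda>\<nu>. \<nu> j) (at_right (0::real)))"
    using assms by (subst eventually_INF_finite) (auto intro!: exI[of _ "\<lambda>j \<nu>. \<nu> j < \<epsilon>"])
  then have "eventually (\<lambda>\<nu>. \<nu> \<in> T_bar I J \<nu>' \<longrightarrow> P \<nu>)
      (INF j\<in>I - J. filtercomap (\<lambda>\<nu>. \<nu> j) (at_right (0::real)))"
    by (rule eventually_mono) (use \<epsilon>(2) in auto)
  then show "eventually P (vanishing_in_T_bar I J \<nu>')"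
    by (simp add: vanishing_in_T_bar_def inf_commute[of "principal _"] eventually_inf_principal)
qed

lemma vanishing_in_T_bar_neq_bot:
  assumes "finite I" "J \<subseteq> I" "\<nu>' \<in> pos_orthant J"
  shows "vanishing_in_T_bar I J \<nu>' \<noteq> bot"
proof
  assume "vanishing_in_T_bar I J \<nu>' = bot"
  then obtain \<epsilon> where \<epsilon>: "\<epsilon> > 0" "\<And>\<nu>. \<nu> \<in> T_bar I J \<nu>' \<Longrightarrow> \<not> (\<forall>j\<in>I - J. \<nu> j < \<epsilon>)"
    using eventually_vanishing_in_T_bar[OF assms(1), of "\<lambda>_. False" J \<nu>'] by auto
  let ?\<nu> = "\<lambda>j\<in>I. if j \<in> J then \<nu>' j else \<epsilon> / 2"
  have "?\<nu> \<in> T_bar I J \<nu>'"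
    using assms \<epsilon>(1) by (auto simp: T_bar_def pos_orthant_def PiE_def Pi_def)
  then show False
    using \<epsilon> by fastforce
qed

end

theory Submission imports Defs begin

text \<open>Adjoining the components outside \<open>J\<close>, with levels of intensities \<open>\<nu>\<^sub>j\<close>, changes both
  $n P(\bigcup_j \ldots)$ and the probability of no upcrossing by at most
  $\sum_{j \notin J} n P(X_{1,j} \le u_{n,j} < X_{2,j}) \to \sum_{j \notin J} \nu_j$. Letting these
  \<open>\<nu>\<^sub>j\<close> tend to \<open>0\<close> shows that the quantities belonging to \<open>J\<close> converge as \<open>n \<rightarrow> \<infinity>\<close> and that
  their limits are the limits of \<open>- ln (\<phi> \<nu>)\<close> and \<open>\<phi> \<nu> powr \<eta> \<nu>\<close>. As \<open>J\<close> is nonempty, the first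
  limit is positive, so the index can be recovered from the two limits.\<close>

section \<open>Interchange of limits and the filter of vanishing intensities\<close>

text \<open>A Moore-Osgood argument in which the approximants \<open>c\<close> and errors
  \<open>e\<close> may depend on \<open>t\<close>. One \<open>t\<close> with small
  \<open>s t\<close> already makes \<open>b\<close> Cauchy. Once \<open>b\<close> has a limit
  \<open>B\<close>, letting n grow for each fixed \<open>t\<close> gives the bound
  \<open>s t\<close> on the distance from \<open>g t\<close> to \<open>B\<close>.\<close>

lemma tendsto_interchange:
  fixes b :: "nat \<Rightarrow> real" and g s :: "'b \<Rightarrow> real"
  assumes "F \<noteq> bot" and s: "(s \<longlongrightarrow> 0) F"
    and approx: "\<forall>\<^sub>F t in F. \<exists>c e. c \<longlonglongrightarrow> g t \<and> e \<longlonglongrightarrow> s t \<and> (\<forall>n. \<bar>b n - c n\<bar> \<le> e n)"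
  shows "\<exists>B. b \<longlonglongrightarrow> B \<and> (g \<longlongrightarrow> B) F"
proof -
  have "Cauchy b"
  proof (rule metric_CauchyI)
    fix \<epsilon> :: real assume "\<epsilon> > 0"
    then have "\<forall>\<^sub>F t in F. s t < \<epsilon> / 4"
      using s by (intro order_tendstoD(2)) auto
    with approx have "\<forall>\<^sub>F t in F. s t < \<epsilon> / 4 \<and>
        (\<exists>c e. c \<longlonglongrightarrow> g t \<and> e \<longlonglongrightarrow> s t \<and> (\<forall>n. \<bar>b n - c n\<bar> \<le> e n))"
      by eventually_elim blast
    then obtain t c e where t: "s t < \<epsilon> / 4" "c \<longlonglongrightarrow> g t" "e \<longlonglongrightarrow> s t" "\<And>n. \<bar>b n - c n\<bar> \<le> e n"
      using eventually_happens'[OF \<open>F \<noteq> bot\<close>] by blast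
    \<comment> \<open>With \<open>t\<close> fixed, the two quarters place \<open>b n\<close> within
      \<epsilon>/2 of the single number \<open>g t\<close> for all large n, so any two late terms
      differ by less than \<epsilon>.\<close>
    have "\<forall>\<^sub>F n in sequentially. e n < \<epsilon> / 4"
      using t by (intro order_tendstoD(2))
    moreover have "\<forall>\<^sub>F n in sequentially. dist (c n) (g t) < \<epsilon> / 4"
      using t \<open>\<epsilon> > 0\<close> by (intro tendstoD) auto
    ultimately have "\<forall>\<^sub>F n in sequentially. \<bar>b n - g t\<bar> < \<epsilon> / 2"
    proof eventually_elim
      case (elim n)
      with t(4)[of n] show ?case unfolding dist_real_def by linarith
    qed
    then obtain N where N: "\<And>n. n \<ge> N \<Longrightarrow> \<bar>b n - g t\<bar> < \<epsilon> / 2"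
      by (auto simp: eventually_sequentially)
    have "dist (b m) (b n) < \<epsilon>" if "m \<ge> N" "n \<ge> N" for m n
      using N[OF that(1)] N[OF that(2)] unfolding dist_real_def by linarith
    then show "\<exists>N. \<forall>m\<ge>N. \<forall>n\<ge>N. dist (b m) (b n) < \<epsilon>"
      by blast
  qed
  then obtain B where B: "b \<longlonglongrightarrow> B"
    by (auto simp: Cauchy_convergent_iff convergent_def)
  from approx have "\<forall>\<^sub>F t in F. norm (g t - B) \<le> s t"
  proof eventually_elim
    case (elim t)
    then obtain c e where c: "c \<longlonglongrightarrow> g t" "e \<longlonglongrightarrow> s t" "\<And>n. \<bar>b n - c n\<bar> \<le> e n"
      by blast
    have "(\<lambda>n. \<bar>b n - c n\<bar>) \<longlonglongrightarrow> \<bar>B - g t\<bar>"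
      by (intro tendsto_intros B c)
    then have "\<bar>B - g t\<bar> \<le> s t"
      using c by (intro LIMSEQ_le[where Y = e]) auto
    then show ?case by simp
  qed
  then have "((\<lambda>t. g t - B) \<longlongrightarrow> 0) F"
    by (rule Lim_null_comparison[OF _ s])
  with B show ?thesis
    by (auto simp: LIM_zero_iff)
qed

lemma tendsto_sum_vanishing_in_T_bar:
  "((\<lambda>\<nu>. \<Sum>j\<in>I - J. \<nu> j) \<longlongrightarrow> 0) (vanishing_in_T_bar I J \<nu>')"
proof -
  have "((\<lambda>\<nu>. \<nu> j) \<longlongrightarrow> 0) (vanishing_in_T_bar I J \<nu>')" if "j \<in> I - J" for j
  proof -
    have "vanishing_in_T_bar I J \<nu>' \<le> filtercomap (\<lambda>\<nu>. \<nu> j) (at_right 0)"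
      unfolding vanishing_in_T_bar_def using that by (intro le_infI2 INF_lower)
    then have "filterlim (\<lambda>\<nu>. \<nu> j) (at_right (0::real)) (vanishing_in_T_bar I J \<nu>')"
      by (rule filterlim_mono[OF filterlim_filtercomap order_refl])
    then show ?thesis
      by (rule filterlim_mono) (auto simp: at_within_def)
  qed
  then have "((\<lambda>\<nu>. \<Sum>j\<in>I - J. \<nu> j) \<longlongrightarrow> (\<Sum>j\<in>I - J. 0)) (vanishing_in_T_bar I J \<nu>')"
    by (intro tendsto_sum)
  then show ?thesis by simp
qed

lemma eventually_in_T_bar: "\<forall>\<^sub>F \<nu> in vanishing_in_T_bar I J \<nu>'. \<nu> \<in> T_bar I J \<nu>'"
  unfolding vanishing_in_T_bar_def by (auto intro!: filter_leD[OF inf_le1] simp: eventually_principal)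

text \<open>Every atom i/n with 1 <= i <= n lies in [0,1], so the indicator is 1 and a sum of
  nonnegative terms remains.\<close>

lemma upcrossing_process_unit_interval_eq_0_iff:
  "upcrossing_process X u n j \<omega> {0..1} = 0 \<longleftrightarrow>
    (\<forall>i\<in>{1..n}. \<not> (X i j \<omega> \<le> u n j \<and> u n j < X (i + 1) j \<omega>))"
proof -
  have "upcrossing_process X u n j \<omega> {0..1} =
      (\<Sum>i=1..n. of_bool (X i j \<omega> \<le> u n j \<and> u n j < X (i + 1) j \<omega>))"
    unfolding upcrossing_process_def by (intro sum.cong) auto
  then show ?thesis
    by (simp only:) (subst sum_nonneg_eq_0_iff; auto)
qed

section \<open>Upcrossing events and stationarity\<close>

context stationary_sequence
begin

text \<open>The level is a bare number: for given n all times 1, ..., n share the level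
  \<open>u n j\<close>, so stationarity can shift the event in time.\<close>

definition upcrossing :: "nat \<Rightarrow> 'i \<Rightarrow> real \<Rightarrow> 'a set" where
  "upcrossing i j a = {\<omega> \<in> space M. X i j \<omega> \<le> a \<and> a < X (i + 1) j \<omega>}"

lemma upcrossing_1: "upcrossing 1 j a = {\<omega> \<in> space M. X 1 j \<omega> \<le> a \<and> a < X 2 j \<omega>}"
  by (simp add: upcrossing_def numeral_2_eq_2)

lemma sets_upcrossing [measurable]:
  assumes "i \<ge> 1" "j \<in> I"
  shows "upcrossing i j a \<in> events"
proof -
  have [measurable]: "X i j \<in> borel_measurable M" "X (i + 1) j \<in> borel_measurable M"
    using assms by (auto intro: measurable_X)
  show ?thesis
    unfolding upcrossing_def by measurable
qed

lemma measurable_finite_block: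
  assumes "N \<subseteq> {1..}" "J \<subseteq> I"
  shows "(\<lambda>\<omega>. \<lambda>n\<in>N. \<lambda>j\<in>J. X (n + h) j \<omega>) \<in> M \<rightarrow>\<^sub>M (\<Pi>\<^sub>M n\<in>N. \<Pi>\<^sub>M j\<in>J. borel)"
  using assms by (intro measurable_restrict measurable_X) auto

text \<open>The law of a block of \<open>J\<close>-components is the image of the law of the block
  of \<open>I\<close>-components under restriction of coordinates, for every shift; stationarity on
  \<open>I\<close> is pushed forward along this map.\<close>

lemma stationary_sequence_subset:
  assumes "J \<subseteq> I" "J \<noteq> {}"
  shows "stationary_sequence M J X"
proof unfold_locales
  show "finite J" using finite_index assms(1) by (rule finite_subset[rotated])
  show "X n j \<in> borel_measurable M" if "n \<ge> 1" "j \<in> J" for n j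
    using that assms by (intro measurable_X) auto
next
  fix N :: "nat set" and h :: nat
  assume N: "finite N" "N \<subseteq> {1..}"
  let ?r = "\<lambda>f. \<lambda>n\<in>N. restrict (f n) J"
  let ?PI = "\<Pi>\<^sub>M n\<in>N. \<Pi>\<^sub>M j\<in>I. (borel :: real measure)"
  let ?PJ = "\<Pi>\<^sub>M n\<in>N. \<Pi>\<^sub>M j\<in>J. (borel :: real measure)"
  have r: "?r \<in> ?PI \<rightarrow>\<^sub>M ?PJ"
  proof (rule measurable_restrict)
    show "(\<lambda>f. restrict (f n) J) \<in> ?PI \<rightarrow>\<^sub>M (\<Pi>\<^sub>M j\<in>J. borel)" if "n \<in> N" for n
      by (rule measurable_compose[where f = "\<lambda>f. f n" and g = "\<lambda>g. restrict g J",
            OF measurable_component_singleton[OF that] measurable_restrict_subset[OF assms(1)]])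
  qed
  have block: "distr M ?PJ (\<lambda>\<omega>. \<lambda>n\<in>N. \<lambda>j\<in>J. X (n + k) j \<omega>) =
      distr (distr M ?PI (\<lambda>\<omega>. \<lambda>n\<in>N. \<lambda>j\<in>I. X (n + k) j \<omega>)) ?PJ ?r" for k
  proof -
    have "?r (\<lambda>n\<in>N. \<lambda>j\<in>I. X (n + k) j \<omega>) = (\<lambda>n\<in>N. \<lambda>j\<in>J. X (n + k) j \<omega>)" for \<omega>
      using assms by (auto simp: restrict_def fun_eq_iff)
    then show ?thesis
      by (subst distr_distr[OF r measurable_finite_block[OF N(2) order_refl]]) (simp add: comp_def)
  qed
  show "distr M ?PJ (\<lambda>\<omega>. \<lambda>n\<in>N. \<lambda>j\<in>J. X (n + h) j \<omega>) = distr M ?PJ (\<lambda>\<omega>. \<lambda>n\<in>N. \<lambda>j\<in>J. X n j \<omega>)"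
    using block[of h] block[of 0] stationary[OF N, of h] by simp
qed (use assms in auto)

text \<open>An upcrossing at time i involves only times i and i + 1, that is, the block {1, 2}
  shifted by i - 1. For every shift the event is the preimage of the same measurable set
  \<open>?A\<close>, so stationarity of the block suffices.\<close>

lemma prob_upcrossing:
  assumes "i \<ge> 1" "j \<in> I"
  shows "prob (upcrossing i j a) = prob (upcrossing 1 j a)"
proof -
  let ?P = "\<Pi>\<^sub>M n\<in>{1, 2::nat}. \<Pi>\<^sub>M j\<in>I. (borel :: real measure)"
  let ?block = "\<lambda>k \<omega>. \<lambda>n\<in>{1, 2}. \<lambda>j\<in>I. X (n + k) j \<omega>"
  let ?A = "{f \<in> space ?P. f 1 j \<le> a \<and> a < f 2 j}"
  have component: "(\<lambda>f. f n j) \<in> borel_measurable ?P" if "n \<in> {1, 2}" for n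
    by (rule measurable_compose[where N = "\<Pi>\<^sub>M j\<in>I. borel"])
      (use that assms in \<open>auto intro: measurable_component_singleton\<close>)
  have A: "?A \<in> sets ?P"
  proof -
    have [measurable]: "(\<lambda>f. f 1 j) \<in> borel_measurable ?P" "(\<lambda>f. f 2 j) \<in> borel_measurable ?P"
      by (rule component, simp)+
    show ?thesis by measurable
  qed
  have meas: "?block k \<in> M \<rightarrow>\<^sub>M ?P" for k
    by (rule measurable_finite_block) auto
  have "prob (upcrossing (k + 1) j a) = measure (distr M ?P (?block k)) ?A" for k
  proof -
    have "?block k -` ?A \<inter> space M = upcrossing (k + 1) j a"
      using assms(2) measurable_space[OF meas[of k]]
      by (auto simp: upcrossing_def simp del: space_PiM)
    then show ?thesis
      by (simp only: measure_distr[OF meas A])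
  qed
  from this[of "i - 1"] this[of 0] show ?thesis
    using stationary[of "{1, 2}" "i - 1"] assms(1) by simp
qed

section \<open>Comparison of \<open>J\<close> with \<open>I\<close> at fixed n\<close>

definition intensity :: "'i set \<Rightarrow> (nat \<Rightarrow> 'i \<Rightarrow> real) \<Rightarrow> nat \<Rightarrow> real" where
  "intensity K u n = real n * prob (\<Union>j\<in>K. upcrossing 1 j (u n j))"

definition prob_no_upcrossing :: "'i set \<Rightarrow> (nat \<Rightarrow> 'i \<Rightarrow> real) \<Rightarrow> nat \<Rightarrow> real" where
  "prob_no_upcrossing K u n = prob (space M - (\<Union>j\<in>K. \<Union>i\<in>{1..n}. upcrossing i j (u n j)))"

lemma levels_iff:
  "levels M K X \<nu> u \<longleftrightarrow> (\<forall>j\<in>K. (\<lambda>n. real n * prob (upcrossing 1 j (u n j))) \<longlonglongrightarrow> \<nu> j)"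
  by (simp add: levels_def upcrossing_1 del: One_nat_def)

lemma has_upcrossings_index_iff:
  "has_upcrossings_index M K X \<eta> \<longleftrightarrow>
     (\<exists>\<phi>. \<forall>\<nu>\<in>pos_orthant K. (\<exists>u. levels M K X \<nu> u) \<and> 0 \<le> \<eta> \<nu> \<and> \<eta> \<nu> \<le> 1 \<and>
        (\<forall>u. levels M K X \<nu> u \<longrightarrow> (\<lambda>n. exp (- intensity K u n)) \<longlonglongrightarrow> \<phi> \<nu> \<and>
           prob_no_upcrossing K u \<longlonglongrightarrow> \<phi> \<nu> powr \<eta> \<nu>))"
proof -
  have "{\<omega> \<in> space M. \<forall>j\<in>K. upcrossing_process X u n j \<omega> {0..1} = 0} =
      space M - (\<Union>j\<in>K. \<Union>i\<in>{1..n}. upcrossing i j (u n j))" for u n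
    by (auto simp: upcrossing_process_unit_interval_eq_0_iff upcrossing_def)
  then show ?thesis
    by (simp add: has_upcrossings_index_def intensity_def prob_no_upcrossing_def [abs_def]
        upcrossing_1 del: One_nat_def)
qed

text \<open>This and the next lemma allow levels given on \<open>J\<close> to be replaced by an
  extension to \<open>I\<close> without changing the quantities for \<open>J\<close>.\<close>

lemma intensity_cong:
  "(\<And>j. j \<in> K \<Longrightarrow> u n j = v n j) \<Longrightarrow> intensity K u n = intensity K v n"
  by (simp add: intensity_def)

lemma prob_no_upcrossing_cong:
  "(\<And>j. j \<in> K \<Longrightarrow> u n j = v n j) \<Longrightarrow> prob_no_upcrossing K u n = prob_no_upcrossing K v n"
  by (simp add: prob_no_upcrossing_def)

lemma intensity_le_sum:
  assumes "K \<subseteq> I"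
  shows "intensity K u n \<le> (\<Sum>j\<in>K. real n * prob (upcrossing 1 j (u n j)))"
proof -
  have "finite K" using assms finite_index by (rule finite_subset)
  then have "prob (\<Union>j\<in>K. upcrossing 1 j (u n j)) \<le> (\<Sum>j\<in>K. prob (upcrossing 1 j (u n j)))"
    using assms by (intro finite_measure_subadditive_finite) auto
  then show ?thesis
    by (simp add: intensity_def sum_distrib_left[symmetric] mult_left_mono)
qed

lemma intensity_ge:
  assumes "K \<subseteq> I" "j \<in> K"
  shows "real n * prob (upcrossing 1 j (u n j)) \<le> intensity K u n"
proof -
  have "finite K" using assms(1) finite_index by (rule finite_subset)
  then have "prob (upcrossing 1 j (u n j)) \<le> prob (\<Union>j\<in>K. upcrossing 1 j (u n j))"
    using assms by (intro finite_measure_mono sets.finite_UN) auto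
  then show ?thesis
    by (simp add: intensity_def mult_left_mono)
qed

text \<open>The union over \<open>I\<close> exceeds the union over \<open>J\<close> by at most the
  union over \<open>I - J\<close>, to which the union bound applies.\<close>

lemma intensity_diff:
  assumes "J \<subseteq> I"
  shows "\<bar>intensity J u n - intensity I u n\<bar> \<le> (\<Sum>j\<in>I - J. real n * prob (upcrossing 1 j (u n j)))"
proof -
  let ?U = "\<lambda>K. \<Union>j\<in>K. upcrossing 1 j (u n j)"
  have ev: "?U K \<in> events" if "K \<subseteq> I" for K
    using that finite_subset[OF that finite_index] by (intro sets.finite_UN) auto
  have "prob (?U J) \<le> prob (?U I)"
    using assms ev[of I] by (intro finite_measure_mono) auto
  then have 1: "intensity J u n \<le> intensity I u n"
    by (simp add: intensity_def mult_left_mono)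
  have "prob (?U I) \<le> prob (?U J \<union> ?U (I - J))"
    using assms ev[of J] ev[of "I - J"] by (intro finite_measure_mono) auto
  also have "\<dots> \<le> prob (?U J) + prob (?U (I - J))"
    using ev assms by (intro measure_Un_le) auto
  finally have "intensity I u n \<le> intensity J u n + intensity (I - J) u n"
    by (simp add: intensity_def distrib_left[symmetric] mult_left_mono)
  with 1 intensity_le_sum[of "I - J" u n] show ?thesis
    by auto
qed

text \<open>If \<open>J\<close> has no upcrossing but \<open>I\<close> has one, some component in
  \<open>I - J\<close> upcrosses at one of the times 1, ..., n. The union bound runs over components
  and times; by stationarity the n times contribute equally, which produces the factor n and the
  same error as for the intensities.\<close>

lemma prob_no_upcrossing_diff:
  assumes "J \<subseteq> I"
  shows "\<bar>prob_no_upcrossing J u n - prob_no_upcrossing I u n\<bar>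
    \<le> (\<Sum>j\<in>I - J. real n * prob (upcrossing 1 j (u n j)))"
proof -
  let ?U = "\<lambda>K. \<Union>j\<in>K. \<Union>i\<in>{1..n}. upcrossing i j (u n j)"
  have ev: "?U K \<in> events" if "K \<subseteq> I" for K
    using that finite_subset[OF that finite_index] by (intro sets.finite_UN) auto
  have 1: "prob_no_upcrossing I u n \<le> prob_no_upcrossing J u n"
    unfolding prob_no_upcrossing_def
    using assms ev[of J] by (intro finite_measure_mono) auto
  have "prob_no_upcrossing J u n \<le> prob ((space M - ?U I) \<union> ?U (I - J))"
    unfolding prob_no_upcrossing_def
    using assms ev[of I] ev[of "I - J"] by (intro finite_measure_mono) auto
  also have "\<dots> \<le> prob_no_upcrossing I u n + prob (?U (I - J))"
    unfolding prob_no_upcrossing_def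
    using ev assms by (intro measure_Un_le) auto
  also have "prob (?U (I - J)) \<le> (\<Sum>j\<in>I - J. prob (\<Union>i\<in>{1..n}. upcrossing i j (u n j)))"
    using finite_index by (intro finite_measure_subadditive_finite) auto
  also have "\<dots> \<le> (\<Sum>j\<in>I - J. \<Sum>i\<in>{1..n}. prob (upcrossing i j (u n j)))"
    by (intro sum_mono finite_measure_subadditive_finite) auto
  also have "\<dots> = (\<Sum>j\<in>I - J. real n * prob (upcrossing 1 j (u n j)))"
  proof (rule sum.cong[OF refl])
    fix j assume "j \<in> I - J"
    then have "(\<Sum>i\<in>{1..n}. prob (upcrossing i j (u n j))) = (\<Sum>i\<in>{1..n}. prob (upcrossing 1 j (u n j)))"
      by (intro sum.cong prob_upcrossing) auto
    then show "(\<Sum>i\<in>{1..n}. prob (upcrossing i j (u n j))) = real n * prob (upcrossing 1 j (u n j))"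
      by simp
  qed
  finally show ?thesis using 1 by simp
qed

section \<open>Limits as n grows and recovery of the index\<close>

text \<open>The union bound keeps the intensity below a sequence tending to the sum of the \<nu> j,
  so \<open>p\<close> is at least the exponential of minus that sum. Hence \<open>p\<close> is
  positive and the logarithm is continuous there.\<close>

lemma intensity_tendsto:
  assumes lim: "(\<lambda>n. exp (- intensity I u n)) \<longlonglongrightarrow> p" and u: "levels M I X \<nu> u"
  shows "p > 0" and "intensity I u \<longlonglongrightarrow> - ln p"
proof -
  have "(\<lambda>n. exp (- (\<Sum>j\<in>I. real n * prob (upcrossing 1 j (u n j))))) \<longlonglongrightarrow> exp (- (\<Sum>j\<in>I. \<nu> j))"
    using u by (intro tendsto_intros) (auto simp: levels_iff)
  then have "exp (- (\<Sum>j\<in>I. \<nu> j)) \<le> p"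
    by (rule LIMSEQ_le[OF _ lim]) (use intensity_le_sum in auto)
  then show "p > 0"
    by (rule less_le_trans[rotated]) simp
  then have "(\<lambda>n. - ln (exp (- intensity I u n))) \<longlonglongrightarrow> - ln p"
    by (intro tendsto_intros lim) auto
  then show "intensity I u \<longlonglongrightarrow> - ln p" by simp
qed

text \<open>The claim for one fixed \<nu>', with numbers \<open>p\<close> and \<open>e\<close> in
  place of functions; the functions are chosen afterwards.\<close>

lemma subset_limits:
  assumes J: "J \<subseteq> I" "J \<noteq> {}" and \<nu>': "\<nu>' \<in> pos_orthant J"
    and index: "\<And>\<nu>. \<nu> \<in> pos_orthant I \<Longrightarrow> (\<exists>u. levels M I X \<nu> u) \<and> 0 \<le> \<eta> \<nu> \<and> \<eta> \<nu> \<le> 1 \<and>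
      (\<forall>u. levels M I X \<nu> u \<longrightarrow> (\<lambda>n. exp (- intensity I u n)) \<longlonglongrightarrow> \<phi> \<nu> \<and>
         prob_no_upcrossing I u \<longlonglongrightarrow> \<phi> \<nu> powr \<eta> \<nu>)"
  shows "\<exists>p e. (\<exists>u. levels M J X \<nu>' u) \<and> 0 \<le> e \<and> e \<le> 1 \<and>
      (\<forall>u. levels M J X \<nu>' u \<longrightarrow> (\<lambda>n. exp (- intensity J u n)) \<longlonglongrightarrow> p \<and>
         prob_no_upcrossing J u \<longlonglongrightarrow> p powr e) \<and>
      (\<eta> \<longlongrightarrow> e) (vanishing_in_T_bar I J \<nu>')"
proof -
  let ?F = "vanishing_in_T_bar I J \<nu>'"
  have nontriv: "?F \<noteq> bot"
    using finite_index J(1) \<nu>' by (rule vanishing_in_T_bar_neq_bot)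
  have T: "\<nu> \<in> pos_orthant I" "\<And>j. j \<in> J \<Longrightarrow> \<nu> j = \<nu>' j" if "\<nu> \<in> T_bar I J \<nu>'" for \<nu>
    using that by (auto simp: T_bar_def)
  have pos: "\<phi> \<nu> > 0" if "\<nu> \<in> pos_orthant I" for \<nu>
  proof -
    from index[OF that] obtain u where "levels M I X \<nu> u" "(\<lambda>n. exp (- intensity I u n)) \<longlonglongrightarrow> \<phi> \<nu>"
      by blast
    then show ?thesis by (intro intensity_tendsto(1))
  qed
  \<comment> \<open>Here \<open>L\<close> and \<open>B\<close> may still depend on \<open>u\<close>;
    this is removed in \<open>unique\<close>.\<close>
  have lims: "\<exists>L B. intensity J u \<longlonglongrightarrow> L \<and> prob_no_upcrossing J u \<longlonglongrightarrow> B \<and>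
      ((\<lambda>\<nu>. - ln (\<phi> \<nu>)) \<longlongrightarrow> L) ?F \<and> ((\<lambda>\<nu>. \<phi> \<nu> powr \<eta> \<nu>) \<longlongrightarrow> B) ?F"
    if u: "levels M J X \<nu>' u" for u
  proof -
    have extend: "\<exists>v. levels M I X \<nu> v \<and> (\<forall>n. \<forall>j\<in>J. v n j = u n j)"
      if \<nu>: "\<nu> \<in> T_bar I J \<nu>'" for \<nu>
    proof -
      from index[OF T(1)[OF \<nu>]] obtain w where w: "levels M I X \<nu> w"
        by blast
      \<comment> \<open>Components in \<open>J\<close> keep the given levels, the others are
        borrowed from arbitrary levels for \<nu>. The two fit together because \<nu> agrees with
        \<nu>' on \<open>J\<close>.\<close>
      let ?v = "\<lambda>n j. if j \<in> J then u n j else w n j"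
      have "levels M I X \<nu> ?v"
        unfolding levels_iff
      proof
        fix j assume "j \<in> I"
        then show "(\<lambda>n. real n * prob (upcrossing 1 j (?v n j))) \<longlonglongrightarrow> \<nu> j"
          using w u T(2)[OF \<nu>] by (cases "j \<in> J") (auto simp: levels_iff)
      qed
      then show ?thesis
        by (intro exI[of _ ?v]) simp
    qed
    have err: "(\<lambda>n. \<Sum>j\<in>I - J. real n * prob (upcrossing 1 j (v n j))) \<longlonglongrightarrow> (\<Sum>j\<in>I - J. \<nu> j)"
      if "levels M I X \<nu> v" for \<nu> v
      using that by (intro tendsto_sum) (auto simp: levels_iff)
    have "\<exists>L. intensity J u \<longlonglongrightarrow> L \<and> ((\<lambda>\<nu>. - ln (\<phi> \<nu>)) \<longlongrightarrow> L) ?F"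
    proof (rule tendsto_interchange[OF nontriv tendsto_sum_vanishing_in_T_bar],
        rule eventually_mono[OF eventually_in_T_bar])
      fix \<nu> assume \<nu>: "\<nu> \<in> T_bar I J \<nu>'"
      from extend[OF \<nu>] obtain v where v: "levels M I X \<nu> v" "\<And>n j. j \<in> J \<Longrightarrow> v n j = u n j"
        by blast
      have lim: "intensity I v \<longlonglongrightarrow> - ln (\<phi> \<nu>)"
        using index[OF T(1)[OF \<nu>]] v(1) by (intro intensity_tendsto(2)) auto
      have eq: "intensity J u = intensity J v"
        using v(2) by (intro ext intensity_cong) simp
      show "\<exists>c e. c \<longlonglongrightarrow> - ln (\<phi> \<nu>) \<and> e \<longlonglongrightarrow> (\<Sum>j\<in>I - J. \<nu> j) \<and>
          (\<forall>n. \<bar>intensity J u n - c n\<bar> \<le> e n)"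
        unfolding eq 
        by (rule exI, rule exI, intro conjI allI, rule lim, rule err[OF v(1)], rule intensity_diff[OF J(1)])
    qed
    moreover have "\<exists>B. prob_no_upcrossing J u \<longlonglongrightarrow> B \<and> ((\<lambda>\<nu>. \<phi> \<nu> powr \<eta> \<nu>) \<longlongrightarrow> B) ?F"
    proof (rule tendsto_interchange[OF nontriv tendsto_sum_vanishing_in_T_bar],
        rule eventually_mono[OF eventually_in_T_bar])
      fix \<nu> assume \<nu>: "\<nu> \<in> T_bar I J \<nu>'"
      from extend[OF \<nu>] obtain v where v: "levels M I X \<nu> v" "\<And>n j. j \<in> J \<Longrightarrow> v n j = u n j"
        by blast
      have lim: "prob_no_upcrossing I v \<longlonglongrightarrow> \<phi> \<nu> powr \<eta> \<nu>"
        using index[OF T(1)[OF \<nu>]] v(1) by auto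
      have eq: "prob_no_upcrossing J u = prob_no_upcrossing J v"
        using v(2) by (intro ext prob_no_upcrossing_cong) simp
      show "\<exists>c e. c \<longlonglongrightarrow> \<phi> \<nu> powr \<eta> \<nu> \<and> e \<longlonglongrightarrow> (\<Sum>j\<in>I - J. \<nu> j) \<and>
          (\<forall>n. \<bar>prob_no_upcrossing J u n - c n\<bar> \<le> e n)"
        unfolding eq 
        by (rule exI, rule exI, intro conjI allI, rule lim, rule err[OF v(1)], rule prob_no_upcrossing_diff[OF J(1)])
    qed
    ultimately show ?thesis by blast
  qed
  \<comment> \<open>Levels for \<nu>' exist: those of any \<nu>0 extending \<nu>' serve on
    \<open>J\<close>.\<close>
  obtain \<nu>0 where \<nu>0: "\<nu>0 \<in> T_bar I J \<nu>'"
    using eventually_happens'[OF nontriv eventually_in_T_bar] by blast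
  then obtain u0 where "levels M I X \<nu>0 u0"
    using index[OF T(1)[OF \<nu>0]] by blast
  then have u0: "levels M J X \<nu>' u0"
    using J(1) by (auto simp: levels_iff T(2)[OF \<nu>0, symmetric])
  obtain L B where LB: "intensity J u0 \<longlonglongrightarrow> L" "((\<lambda>\<nu>. - ln (\<phi> \<nu>)) \<longlongrightarrow> L) ?F"
      "((\<lambda>\<nu>. \<phi> \<nu> powr \<eta> \<nu>) \<longlongrightarrow> B) ?F"
    using lims[OF u0] by blast
  \<comment> \<open>The limits of -ln \<phi> and of \<phi> powr \<eta> along \<open>?F\<close> do
    not involve \<open>u\<close>, so uniqueness of limits gives all levels the same \<open>L\<close>
    and \<open>B\<close>.\<close>
  have unique: "intensity J u \<longlonglongrightarrow> L" "prob_no_upcrossing J u \<longlonglongrightarrow> B" if "levels M J X \<nu>' u" for u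
  proof -
    from lims[OF that] obtain L' B' where "intensity J u \<longlonglongrightarrow> L'" "prob_no_upcrossing J u \<longlonglongrightarrow> B'"
      "((\<lambda>\<nu>. - ln (\<phi> \<nu>)) \<longlongrightarrow> L') ?F" "((\<lambda>\<nu>. \<phi> \<nu> powr \<eta> \<nu>) \<longlongrightarrow> B') ?F"
      by blast
    moreover from this have "L' = L" "B' = B"
      using LB(2,3) by (auto intro: tendsto_unique[OF nontriv])
    ultimately show "intensity J u \<longlonglongrightarrow> L" "prob_no_upcrossing J u \<longlonglongrightarrow> B"
      by simp_all
  qed
  \<comment> \<open>The intensity of \<open>J\<close> dominates that of any single component j in
    \<open>J\<close>, whose limit is \<nu>' j > 0. Later \<open>L\<close> is a divisor.\<close>
  have "L > 0"
  proof -
    obtain j where j: "j \<in> J" using J(2) by blast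
    have "\<nu>' j \<le> L"
      using u0 j intensity_ge[OF J(1) j, of _ u0]
      by (intro LIMSEQ_le[where X = "\<lambda>n. real n * prob (upcrossing 1 j (u0 n j))", OF _ LB(1)])
        (auto simp: levels_iff)
    moreover have "\<nu>' j > 0"
      using \<nu>' j by (auto simp: pos_orthant_def)
    ultimately show ?thesis by simp
  qed
  have powr_eq: "\<forall>\<^sub>F \<nu> in ?F. \<phi> \<nu> powr \<eta> \<nu> = exp (\<eta> \<nu> * ln (\<phi> \<nu>)) \<and> 0 \<le> \<eta> \<nu> \<and> \<eta> \<nu> \<le> 1"
    using eventually_in_T_bar
  proof eventually_elim
    case (elim \<nu>)
    with index[OF T(1)[OF elim]] pos[OF T(1)[OF elim]] show ?case by (auto simp: powr_def)
  qed
  have "\<forall>\<^sub>F \<nu> in ?F. - ln (\<phi> \<nu>) > 0"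
    using LB(2) \<open>L > 0\<close> by (rule order_tendstoD(1))
  with powr_eq have ev: "\<forall>\<^sub>F \<nu> in ?F. \<phi> \<nu> powr \<eta> \<nu> = exp (\<eta> \<nu> * ln (\<phi> \<nu>)) \<and>
      0 \<le> \<eta> \<nu> \<and> \<eta> \<nu> \<le> 1 \<and> ln (\<phi> \<nu>) < 0"
    by eventually_elim auto
  \<comment> \<open>Eventually \<phi> < 1, so \<eta> <= 1 gives \<phi> <= \<phi> powr \<eta>. In the
    limit exp (-L) <= \<open>B\<close>, so ln \<open>B\<close> is the limit of the
    logarithms.\<close>
  have "((\<lambda>\<nu>. exp (- (- ln (\<phi> \<nu>)))) \<longlongrightarrow> exp (- L)) ?F"
    by (intro tendsto_intros LB)
  moreover have "\<forall>\<^sub>F \<nu> in ?F. exp (- (- ln (\<phi> \<nu>))) \<le> \<phi> \<nu> powr \<eta> \<nu>"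
    using ev
  proof eventually_elim
    case (elim \<nu>)
    then have "ln (\<phi> \<nu>) \<le> \<eta> \<nu> * ln (\<phi> \<nu>)"
      by (simp add: mult_le_cancel_right1)
    with elim show ?case by simp
  qed
  ultimately have "exp (- L) \<le> B"
    by (rule tendsto_le[OF nontriv LB(3)])
  then have "B > 0"
    by (rule less_le_trans[rotated]) simp
  \<comment> \<open>The solution of exp (-L) powr e = B. It is the limit of \<eta> because \<eta> is
    eventually the quotient of ln (\<phi> powr \<eta>) by ln \<phi>, with limits ln \<open>B\<close>
    and -\<open>L\<close>.\<close>
  define e where "e = ln B / (- L)"
  have "((\<lambda>\<nu>. ln (\<phi> \<nu> powr \<eta> \<nu>) / (- (- ln (\<phi> \<nu>)))) \<longlongrightarrow> e) ?F"
    unfolding e_def using \<open>B > 0\<close> \<open>L > 0\<close> by (intro tendsto_intros LB) auto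
  moreover have "\<forall>\<^sub>F \<nu> in ?F. ln (\<phi> \<nu> powr \<eta> \<nu>) / (- (- ln (\<phi> \<nu>))) = \<eta> \<nu>"
    using ev by eventually_elim auto
  ultimately have \<eta>: "(\<eta> \<longlongrightarrow> e) ?F"
    by (rule Lim_transform_eventually)
  have "0 \<le> e" "e \<le> 1"
    using tendsto_lowerbound[OF \<eta> _ nontriv, of 0] tendsto_upperbound[OF \<eta> _ nontriv, of 1]
      eventually_mono[OF powr_eq, of "\<lambda>\<nu>. 0 \<le> \<eta> \<nu>"] eventually_mono[OF powr_eq, of "\<lambda>\<nu>. \<eta> \<nu> \<le> 1"]
    by auto
  moreover have "exp (- L) powr e = B"
    using \<open>B > 0\<close> \<open>L > 0\<close> by (simp add: powr_def e_def)
  moreover have "(\<lambda>n. exp (- intensity J u n)) \<longlonglongrightarrow> exp (- L)" if "levels M J X \<nu>' u" for u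
    by (intro tendsto_intros unique that)
  ultimately show ?thesis
    using u0 \<eta> unique(2) by (intro exI[of _ "exp (- L)"] exI[of _ e]) auto
qed

theorem upcrossings_index_subset:
  assumes J: "J \<subseteq> I" "J \<noteq> {}" and index: "has_upcrossings_index M I X \<eta>"
  shows "\<exists>\<eta>\<^sub>J. has_upcrossings_index M J X \<eta>\<^sub>J \<and>
       (\<forall>\<nu>'\<in>pos_orthant J. (\<eta> \<longlongrightarrow> \<eta>\<^sub>J \<nu>') (vanishing_in_T_bar I J \<nu>'))"
proof -
  from index obtain \<phi> where \<phi>: "\<And>\<nu>. \<nu> \<in> pos_orthant I \<Longrightarrow>
      (\<exists>u. levels M I X \<nu> u) \<and> 0 \<le> \<eta> \<nu> \<and> \<eta> \<nu> \<le> 1 \<and>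
      (\<forall>u. levels M I X \<nu> u \<longrightarrow> (\<lambda>n. exp (- intensity I u n)) \<longlonglongrightarrow> \<phi> \<nu> \<and>
         prob_no_upcrossing I u \<longlonglongrightarrow> \<phi> \<nu> powr \<eta> \<nu>)"
    unfolding has_upcrossings_index_iff by blast
  let ?Q = "\<lambda>\<nu>' p e. (\<exists>u. levels M J X \<nu>' u) \<and> 0 \<le> e \<and> e \<le> 1 \<and>
      (\<forall>u. levels M J X \<nu>' u \<longrightarrow> (\<lambda>n. exp (- intensity J u n)) \<longlonglongrightarrow> p \<and>
         prob_no_upcrossing J u \<longlonglongrightarrow> p powr e) \<and>
      (\<eta> \<longlongrightarrow> e) (vanishing_in_T_bar I J \<nu>')"
  have "\<forall>\<nu>'\<in>pos_orthant J. \<exists>p e. ?Q \<nu>' p e"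
    by (intro ballI subset_limits[OF J _ \<phi>])
  \<comment> \<open>Two successive choices turn the numbers for each \<nu>' into the functions
    \<open>\<phi>\<^sub>J\<close> and \<open>\<eta>\<^sub>J\<close>.\<close>
  from bchoice[OF this] obtain \<phi>\<^sub>J where "\<forall>\<nu>'\<in>pos_orthant J. \<exists>e. ?Q \<nu>' (\<phi>\<^sub>J \<nu>') e" ..
  from bchoice[OF this] obtain \<eta>\<^sub>J where "\<forall>\<nu>'\<in>pos_orthant J. ?Q \<nu>' (\<phi>\<^sub>J \<nu>') (\<eta>\<^sub>J \<nu>')" ..
  then show ?thesis
    unfolding has_upcrossings_index_iff by (intro exI[of _ \<eta>\<^sub>J] conjI exI[of _ \<phi>\<^sub>J]) auto
qed

end

theorem proposition3p1:
  fixes M :: "'a measure" and d :: nat and X :: "nat \<Rightarrow> nat \<Rightarrow> 'a \<Rightarrow> real"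
    and \<eta> :: "(nat \<Rightarrow> real) \<Rightarrow> real" and J :: "nat set"
  assumes "stationary_sequence M {1..d} X"
    and "has_upcrossings_index M {1..d} X \<eta>"
    and "\<forall>\<nu>\<in>pos_orthant {1..d}. \<eta> \<nu> > 0"
    and "J \<noteq> {}" and "J \<subseteq> {1..d}"
  shows "stationary_sequence M J X \<and>
    (\<exists>\<eta>\<^sub>J. has_upcrossings_index M J X \<eta>\<^sub>J \<and>
       (\<forall>\<nu>'\<in>pos_orthant J. (\<eta> \<longlongrightarrow> \<eta>\<^sub>J \<nu>') (vanishing_in_T_bar {1..d} J \<nu>')))"
  using stationary_sequence.stationary_sequence_subset[OF assms(1,5,4)]
    stationary_sequence.upcrossings_index_subset[OF assms(1,5,4,2)]
  by (rule conjI)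

end
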